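(* Let $\mathcal{H}$ be a separable infinite-dimensional Hilbert space with orthonormal basis $\{e_j\}_{j\in\mathbb{N}}$, and let $U,W\in B(\mathcal{H})$ be such that $W$ is invertible and $U$ is unitary. For $m\in\mathbb{N}$ let $P_m$ be the orthogonal projection of $\mathcal{H}$ onto $\mathrm{span}\{e_1,\ldots,e_m\}$. Suppose that for each $m\in\mathbb{N}$ there exists a strictly increasing sequence $\{n_k\}\subseteq\mathbb{N}$ such that $$\lim_{k\to\infty}\sum_{l=1}^\infty\|W^{ln_k}P_m\|=\lim_{k\to\infty}\sum_{l=1}^\infty\|W^{-ln_k}P_m\|=0,$$ where the corresponding series are convergent for each $k$. Then the sequence $(C^{(n)}_{U,W})_{n\in\mathbb{N}_0}$ is chaotic on $B_0(\mathcal{H})$.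
   Context: $B(\mathcal{H})$ is the space of bounded linear operators on $\mathcal{H}$ and $B_0(\mathcal{H})$ the space of compact operators with the operator norm. $T_{U,W}(F):=WFU$, $S_{U,W}(F):=W^{-1}FU^{-1}$, and $C^{(n)}_{U,W}:=\frac12\left(T^n_{U,W}+S^n_{U,W}\right)$ for $n\in\mathbb{N}_0$. A sequence $(T_n)_{n\in\mathbb{N}_0}$ of bounded operators on a Banach space $\mathcal{X}$ is topologically transitive if for all non-empty open $A,B\subseteq\mathcal{X}$ there is $n\in\mathbb{N}$ with $T_n(A)\cap B\neq\varnothing$. A vector $x$ is a periodic element of $(T_n)$ if there is $N\in\mathbb{N}$ such that $T_{kN}x=x$ for every $k\in\mathbb{N}$. The sequence $(T_n)$ is chaotic if it is topologically transitive and its set of periodic elements is dense in $\mathcal{X}$. *)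

theory Defs
  imports "HOL-Analysis.Analysis"
begin

section \<open>Complex Hilbert spaces\<close>

text \<open>The inner product is linear in the first and conjugate-linear in the second argument.\<close>

class complex_inner = real_normed_vector +
  fixes scaleC :: "complex \<Rightarrow> 'a \<Rightarrow> 'a"  (infixr \<open>*\<^sub>C\<close> 75)
    and cinner :: "'a \<Rightarrow> 'a \<Rightarrow> complex"
  assumes scaleC_add_right: "a *\<^sub>C (x + y) = a *\<^sub>C x + a *\<^sub>C y"
    and scaleC_add_left: "(a + b) *\<^sub>C x = a *\<^sub>C x + b *\<^sub>C x"
    and scaleC_scaleC: "a *\<^sub>C b *\<^sub>C x = (a * b) *\<^sub>C x"
    and scaleC_one: "1 *\<^sub>C x = x"
    and scaleR_scaleC: "r *\<^sub>R x = complex_of_real r *\<^sub>C x"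
    and cinner_commute: "cinner x y = cnj (cinner y x)"
    and cinner_add_left: "cinner (x + y) z = cinner x z + cinner y z"
    and cinner_scaleC_left: "cinner (a *\<^sub>C x) y = a * cinner x y"
    and cinner_ge_zero: "0 \<le> Re (cinner x x)"
    and cinner_eq_zero_iff: "cinner x x = 0 \<longleftrightarrow> x = 0"
    and norm_eq_sqrt_cinner: "norm x = sqrt (Re (cinner x x))"

class chilbert_space = complex_inner + complete_space

abbreviation cspan :: "'a::complex_inner set \<Rightarrow> 'a set" where
  "cspan \<equiv> module.span scaleC"

definition orthonormal_basis :: "(nat \<Rightarrow> 'a::complex_inner) \<Rightarrow> bool" where
  "orthonormal_basis e \<longleftrightarrow>
     (\<forall>i j. cinner (e i) (e j) = (if i = j then 1 else 0)) \<and>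
     closure (cspan (range e)) = UNIV"


section \<open>Bounded and compact operators\<close>

text \<open>
  The library type of bounded linear operators consists of the real-linear ones; its norm is the
  operator norm. The operators on a complex space are the complex-linear members of that type.
\<close>

definition bounded_ops :: "('a::complex_inner \<Rightarrow>\<^sub>L 'a) set" where
  "bounded_ops = {F. \<forall>c x. blinfun_apply F (c *\<^sub>C x) = c *\<^sub>C blinfun_apply F x}"

definition compact_ops :: "('a::complex_inner \<Rightarrow>\<^sub>L 'a) set" where
  "compact_ops =
     {F \<in> bounded_ops. \<forall>S. bounded S \<longrightarrow> compact (closure (blinfun_apply F ` S))}"

definition is_inverse_op :: "('a::complex_inner \<Rightarrow>\<^sub>L 'a) \<Rightarrow> ('a \<Rightarrow>\<^sub>L 'a) \<Rightarrow> bool" where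
  "is_inverse_op F G \<longleftrightarrow> G \<in> bounded_ops \<and> G o\<^sub>L F = id_blinfun \<and> F o\<^sub>L G = id_blinfun"

definition invertible_op :: "('a::complex_inner \<Rightarrow>\<^sub>L 'a) \<Rightarrow> bool" where
  "invertible_op F \<longleftrightarrow> (\<exists>G. is_inverse_op F G)"

text \<open>Meaningful for invertible operators only, where the inverse is unique.\<close>

definition inverse_op :: "('a::complex_inner \<Rightarrow>\<^sub>L 'a) \<Rightarrow> ('a \<Rightarrow>\<^sub>L 'a)" where
  "inverse_op F = (THE G. is_inverse_op F G)"

definition is_adjoint :: "('a::complex_inner \<Rightarrow>\<^sub>L 'a) \<Rightarrow> ('a \<Rightarrow>\<^sub>L 'a) \<Rightarrow> bool" where
  "is_adjoint F G \<longleftrightarrow>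
     G \<in> bounded_ops \<and> (\<forall>x y. cinner (blinfun_apply F x) y = cinner x (blinfun_apply G y))"

definition unitary_op :: "('a::complex_inner \<Rightarrow>\<^sub>L 'a) \<Rightarrow> bool" where
  "unitary_op F \<longleftrightarrow> F \<in> bounded_ops \<and>
     (\<exists>G. is_adjoint F G \<and> G o\<^sub>L F = id_blinfun \<and> F o\<^sub>L G = id_blinfun)"

definition op_power :: "('a::complex_inner \<Rightarrow>\<^sub>L 'a) \<Rightarrow> nat \<Rightarrow> ('a \<Rightarrow>\<^sub>L 'a)" where
  "op_power F n = ((\<lambda>G. F o\<^sub>L G) ^^ n) id_blinfun"

definition is_orthogonal_projection ::
  "('a::complex_inner \<Rightarrow>\<^sub>L 'a) \<Rightarrow> 'a set \<Rightarrow> bool" where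
  "is_orthogonal_projection P M \<longleftrightarrow> P \<in> bounded_ops \<and>
     (\<forall>x. blinfun_apply P x \<in> M \<and> (\<forall>y\<in>M. cinner (x - blinfun_apply P x) y = 0))"


section \<open>The operators \<open>T\<close>, \<open>S\<close> and \<open>C\<close>\<close>

definition T_op ::
  "('a::complex_inner \<Rightarrow>\<^sub>L 'a) \<Rightarrow> ('a \<Rightarrow>\<^sub>L 'a) \<Rightarrow> ('a \<Rightarrow>\<^sub>L 'a) \<Rightarrow> ('a \<Rightarrow>\<^sub>L 'a)" where
  "T_op U W F = W o\<^sub>L F o\<^sub>L U"

definition S_op ::
  "('a::complex_inner \<Rightarrow>\<^sub>L 'a) \<Rightarrow> ('a \<Rightarrow>\<^sub>L 'a) \<Rightarrow> ('a \<Rightarrow>\<^sub>L 'a) \<Rightarrow> ('a \<Rightarrow>\<^sub>L 'a)" where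
  "S_op U W F = inverse_op W o\<^sub>L F o\<^sub>L inverse_op U"

definition C_op ::
  "('a::complex_inner \<Rightarrow>\<^sub>L 'a) \<Rightarrow> ('a \<Rightarrow>\<^sub>L 'a) \<Rightarrow> nat \<Rightarrow> ('a \<Rightarrow>\<^sub>L 'a) \<Rightarrow> ('a \<Rightarrow>\<^sub>L 'a)" where
  "C_op U W n F = (1/2) *\<^sub>R ((T_op U W ^^ n) F + (S_op U W ^^ n) F)"


section \<open>Chaotic sequences of operators\<close>

text \<open>
  The underlying Banach space is a subspace \<open>X\<close> of a normed space, with the subspace topology.
\<close>

definition topologically_transitive_on ::
  "'x::real_normed_vector set \<Rightarrow> (nat \<Rightarrow> 'x \<Rightarrow> 'x) \<Rightarrow> bool" where
  "topologically_transitive_on X T \<longleftrightarrow>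
     (\<forall>A B. openin (top_of_set X) A \<and> openin (top_of_set X) B \<and> A \<noteq> {} \<and> B \<noteq> {} \<longrightarrow>
        (\<exists>n\<ge>1. T n ` A \<inter> B \<noteq> {}))"

definition periodic_elements_on ::
  "'x::real_normed_vector set \<Rightarrow> (nat \<Rightarrow> 'x \<Rightarrow> 'x) \<Rightarrow> 'x set" where
  "periodic_elements_on X T = {x \<in> X. \<exists>N\<ge>1. \<forall>k\<ge>1. T (k * N) x = x}"

text \<open>The first conjunct says that the \<open>T n\<close> are operators on \<open>X\<close>.\<close>

definition chaotic_on ::
  "'x::real_normed_vector set \<Rightarrow> (nat \<Rightarrow> 'x \<Rightarrow> 'x) \<Rightarrow> bool" where
  "chaotic_on X T \<longleftrightarrow>
     (\<forall>n. T n ` X \<subseteq> X) \<and>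
     topologically_transitive_on X T \<and>
     X \<subseteq> closure (periodic_elements_on X T)"

end

theory Submission
  imports Defs
begin

text \<open>
  On the range of a projection \<open>P\<^sub>m\<close> the iterates of \<open>T\<close> and of its inverse \<open>S\<close> are summable along the
  multiples of \<open>n = n\<^sub>k\<close>, with small sums, and such operators \<open>P\<^sub>m F\<close> are dense among the compact ones.
  For \<open>D = P\<^sub>m F\<close> the sum of \<open>T\<^sup>l\<^sup>n D\<close> over all integers \<open>l\<close> is close to \<open>D\<close> and fixed by both \<open>T\<^sup>n\<close> and
  \<open>S\<^sup>n\<close>, hence periodic. For \<open>D\<close> and \<open>D'\<close> of this kind, \<open>D + 2 T\<^sup>n D'\<close> is close to \<open>D\<close>, and
  its image under the \<open>n\<close>-th operator is \<open>D' + T\<^sup>2\<^sup>n D' + (T\<^sup>n D + S\<^sup>n D) / 2\<close>, which is close to \<open>D'\<close>.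
\<close>

section \<open>A chaos criterion for cosine sequences\<close>

text \<open>Applying \<open>A\<close> shifts the two-sided orbit by one place: the forward series
  loses its first term \<open>A x\<close>, while the backward series gains \<open>x\<close>, since
  \<open>A\<close> cancels one factor \<open>B\<close>. The middle term makes up the
  difference.\<close>

lemma two_sided_orbit_sum:
  fixes A B :: "'x::banach \<Rightarrow> 'x"
  assumes A: "bounded_linear A" and B: "bounded_linear B"
    and AB: "\<And>x. A (B x) = x"
    and sA: "summable (\<lambda>l. norm ((A ^^ Suc l) x))"
    and sB: "summable (\<lambda>l. norm ((B ^^ Suc l) x))"
  shows "A (x + (\<Sum>l. (A ^^ Suc l) x) + (\<Sum>l. (B ^^ Suc l) x))
         = x + (\<Sum>l. (A ^^ Suc l) x) + (\<Sum>l. (B ^^ Suc l) x)"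
proof -
  have sA': "summable (\<lambda>l. (A ^^ Suc l) x)" and sB': "summable (\<lambda>l. (B ^^ Suc l) x)"
    using sA sB by (blast intro: summable_norm_cancel)+
  have "A (\<Sum>l. (A ^^ Suc l) x) = (\<Sum>l. (A ^^ Suc (Suc l)) x)"
    using bounded_linear.suminf[OF A sA'] by simp
  also have "\<dots> = (\<Sum>l. (A ^^ Suc l) x) - A x"
    using suminf_split_head[OF sA'] by simp
  finally have 1: "A (\<Sum>l. (A ^^ Suc l) x) = (\<Sum>l. (A ^^ Suc l) x) - A x" .
  have s0: "summable (\<lambda>l. (B ^^ l) x)"
    using sB' by (subst (asm) summable_Suc_iff)
  have "A (\<Sum>l. (B ^^ Suc l) x) = (\<Sum>l. (B ^^ l) x)"
    using bounded_linear.suminf[OF A sB'] by (simp add: AB)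
  also have "\<dots> = (\<Sum>l. (B ^^ Suc l) x) + x"
    using suminf_split_head[OF s0] by simp
  finally have 2: "A (\<Sum>l. (B ^^ Suc l) x) = (\<Sum>l. (B ^^ Suc l) x) + x" .
  show ?thesis
    by (simp only: linear_add[OF bounded_linear.linear[OF A]] 1 2) simp
qed

lemma bounded_linear_funpow:
  fixes T :: "'x::real_normed_vector \<Rightarrow> 'x"
  shows "bounded_linear T \<Longrightarrow> bounded_linear (T ^^ n)"
  by (induction n) (auto simp: o_def id_def intro: bounded_linear_compose bounded_linear_ident)

lemma funpow_inverse:
  fixes T S :: "'a \<Rightarrow> 'a"
  assumes "\<And>x. T (S x) = x"
  shows "(T ^^ n) ((S ^^ n) x) = x"
proof (induction n arbitrary: x)
  case (Suc n)
  then show ?case by (simp add: funpow_swap1[of S] assms)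
qed simp

lemma funpow_closed: "(\<And>x. x \<in> X \<Longrightarrow> T x \<in> X) \<Longrightarrow> x \<in> X \<Longrightarrow> (T ^^ n) x \<in> X"
  by (induction n) auto

text \<open>\<open>Suc l\<close> leaves out the zeroth power: \<open>x\<close> itself need not be
  small, only the rest of its orbit along the multiples of \<open>n\<close>.\<close>

definition small_orbit_sum :: "('x::real_normed_vector \<Rightarrow> 'x) \<Rightarrow> nat \<Rightarrow> real \<Rightarrow> 'x \<Rightarrow> bool" where
  "small_orbit_sum T n \<epsilon> x \<longleftrightarrow>
     summable (\<lambda>l. norm ((T ^^ (Suc l * n)) x)) \<and> (\<Sum>l. norm ((T ^^ (Suc l * n)) x)) < \<epsilon>"

lemma small_orbit_sum_term:
  assumes "small_orbit_sum T n \<epsilon> x"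
  shows "norm ((T ^^ (Suc l * n)) x) < \<epsilon>"
proof -
  have "(\<Sum>i\<in>{l}. norm ((T ^^ (Suc i * n)) x)) \<le> (\<Sum>i. norm ((T ^^ (Suc i * n)) x))"
    using assms unfolding small_orbit_sum_def by (intro sum_le_suminf) auto
  then show ?thesis using assms unfolding small_orbit_sum_def by simp
qed

text \<open>The space is a closed subspace \<open>X\<close> of a Banach type because the compact
  operators form a set, not a type. In \<open>dense\<close> one \<open>n\<close> serves both
  vectors, as transitivity needs both orbits to be small at the same time.\<close>

lemma chaotic_cosine_criterion:
  fixes T S :: "'x::banach \<Rightarrow> 'x"
  assumes X: "closed X" "subspace X"
    and T: "bounded_linear T" "\<And>x. x \<in> X \<Longrightarrow> T x \<in> X"
    and S: "bounded_linear S" "\<And>x. x \<in> X \<Longrightarrow> S x \<in> X"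
    and TS: "\<And>x. T (S x) = x" and ST: "\<And>x. S (T x) = x"
    and dense: "\<And>x y \<epsilon>. x \<in> X \<Longrightarrow> y \<in> X \<Longrightarrow> 0 < \<epsilon> \<Longrightarrow>
      \<exists>x'\<in>X. \<exists>y'\<in>X. dist x' x < \<epsilon> \<and> dist y' y < \<epsilon> \<and>
        (\<exists>n\<ge>1. \<forall>z\<in>{x', y'}. small_orbit_sum T n \<epsilon> z \<and> small_orbit_sum S n \<epsilon> z)"
    and C: "\<And>n x. C n x = (1/2) *\<^sub>R ((T ^^ n) x + (S ^^ n) x)"
  shows "chaotic_on X C"
  unfolding chaotic_on_def
proof (intro conjI allI)
  have TX: "(T ^^ n) x \<in> X" and SX: "(S ^^ n) x \<in> X" if "x \<in> X" for n x
    using that T(2) S(2) by (auto intro: funpow_closed)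
  show "C n ` X \<subseteq> X" for n
    by (auto simp: C intro!: subspace_scale[OF X(2)] subspace_add[OF X(2)] TX SX)
  show "X \<subseteq> closure (periodic_elements_on X C)"
  proof
    fix x assume x: "x \<in> X"
    show "x \<in> closure (periodic_elements_on X C)"
      unfolding closure_approachable
    proof (intro allI impI)
      fix \<epsilon> :: real assume "0 < \<epsilon>"
      \<comment> \<open>The three thirds pay for the distance from \<open>x'\<close> to
        \<open>x\<close> and for the forward and backward orbit sums. Only one vector is
        approximated, so \<open>dense\<close> is taken at the pair \<open>x\<close>,
        \<open>x\<close>.\<close>
      then obtain x' n where x': "x' \<in> X" and d: "dist x' x < \<epsilon>/3" and n: "n \<ge> 1"
        and s: "small_orbit_sum T n (\<epsilon>/3) x'" "small_orbit_sum S n (\<epsilon>/3) x'"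
        using dense[OF x x, of "\<epsilon>/3"] by auto
      define A B where "A = T ^^ n" and "B = S ^^ n"
      have pow: "A ^^ l = T ^^ (l * n)" "B ^^ l = S ^^ (l * n)" for l
        by (simp_all add: A_def B_def funpow_mult mult.commute)
      have bl: "bounded_linear A" "bounded_linear B"
        using T S by (simp_all add: A_def B_def bounded_linear_funpow)
      have inv: "A (B z) = z" "B (A z) = z" for z
        using funpow_inverse[of T S, OF TS] funpow_inverse[of S T, OF ST] by (auto simp: A_def B_def)
      have sm: "summable (\<lambda>l. norm ((A ^^ Suc l) x'))" "summable (\<lambda>l. norm ((B ^^ Suc l) x'))"
        and lt: "(\<Sum>l. norm ((A ^^ Suc l) x')) < \<epsilon>/3" "(\<Sum>l. norm ((B ^^ Suc l) x')) < \<epsilon>/3"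
        using s unfolding small_orbit_sum_def pow by auto
      define a b where "a = (\<Sum>l. (A ^^ Suc l) x')" and "b = (\<Sum>l. (B ^^ Suc l) x')"
      define g where "g = x' + a + b"
      have Ag: "A g = g"
        unfolding g_def a_def b_def by (rule two_sided_orbit_sum[OF bl inv(1) sm])
      have Bg: "B g = g"
        using inv(2)[of g] Ag by simp
      \<comment> \<open>Partial sums stay in the subspace and closedness keeps their limit
        there.\<close>
      have Xsum: "suminf f \<in> X" if "summable f" "\<And>l. f l \<in> X" for f :: "nat \<Rightarrow> 'x"
        by (rule closed_sequentially[OF X(1) _ summable_LIMSEQ[OF that(1)]])
          (intro subspace_sum[OF X(2)] that(2))
      have "a \<in> X" unfolding a_def
        by (rule Xsum[OF summable_norm_cancel[OF sm(1)]]) (simp only: pow TX[OF x'])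
      moreover have "b \<in> X" unfolding b_def
        by (rule Xsum[OF summable_norm_cancel[OF sm(2)]]) (simp only: pow SX[OF x'])
      ultimately have gX: "g \<in> X"
        unfolding g_def using x' by (intro subspace_add[OF X(2)])
      \<comment> \<open>Since \<open>g\<close> is fixed by both \<open>T ^^ n\<close> and
        \<open>S ^^ n\<close>, each half of \<open>C (k * n)\<close> returns \<open>g\<close>, and
        \<open>n\<close> is a period.\<close>
      have "(A ^^ k) g = g" "(B ^^ k) g = g" for k
        by (induction k) (auto simp: Ag Bg)
      then have "C (k * n) g = g" for k
        by (simp add: C flip: pow scaleR_2)
      then have "g \<in> periodic_elements_on X C"
        using gX n unfolding periodic_elements_on_def by auto
      moreover have "dist g x < \<epsilon>"
      proof -
        have "norm a < \<epsilon>/3" "norm b < \<epsilon>/3"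
          using summable_norm[OF sm(1)] summable_norm[OF sm(2)] lt unfolding a_def b_def by linarith+
        moreover have "dist g x' \<le> norm a + norm b"
          using norm_triangle_ineq[of a b] by (simp add: g_def dist_norm add.assoc)
        ultimately show ?thesis
          using d dist_triangle[of g x x'] by linarith
      qed
      ultimately show "\<exists>g\<in>periodic_elements_on X C. dist g x < \<epsilon>" by blast
    qed
  qed
  show "topologically_transitive_on X C"
    unfolding topologically_transitive_on_def
  proof (intro allI impI)
    fix O1 O2
    assume "openin (top_of_set X) O1 \<and> openin (top_of_set X) O2 \<and> O1 \<noteq> {} \<and> O2 \<noteq> {}"
    then obtain x y e1 e2 where x: "x \<in> X" and y: "y \<in> X" and e: "0 < e1" "0 < e2"
      and b: "ball x e1 \<inter> X \<subseteq> O1" "ball y e2 \<inter> X \<subseteq> O2"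
      unfolding openin_contains_ball by blast
    \<comment> \<open>Each of the two final distances is below \<open>3 * \<epsilon>\<close>: one
      \<open>\<epsilon>\<close> from the approximation and two from the perturbation.\<close>
    define \<epsilon> where "\<epsilon> = min e1 e2 / 4"
    have \<epsilon>: "0 < \<epsilon>" "4 * \<epsilon> \<le> e1" "4 * \<epsilon> \<le> e2"
      using e by (auto simp: \<epsilon>_def)
    obtain x' y' n where x': "x' \<in> X" and y': "y' \<in> X" and d: "dist x' x < \<epsilon>" "dist y' y < \<epsilon>"
      and n: "n \<ge> 1" and s: "small_orbit_sum T n \<epsilon> x'" "small_orbit_sum S n \<epsilon> x'"
        "small_orbit_sum T n \<epsilon> y'"
      using dense[OF x y \<epsilon>(1)] by auto
    \<comment> \<open>Because of \<open>Suc l\<close>, index 0 is the power \<open>n\<close> and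
      index 1 is the power \<open>2 * n\<close>.\<close>
    have small: "norm ((T ^^ n) x') < \<epsilon>" "norm ((S ^^ n) x') < \<epsilon>" "norm ((T ^^ n) y') < \<epsilon>"
      using s[THEN small_orbit_sum_term, of 0] by simp_all
    have small2: "norm ((T ^^ n) ((T ^^ n) y')) < \<epsilon>"
      using s(3)[THEN small_orbit_sum_term, of 1] by (simp add: funpow_add)
    \<comment> \<open>The factor 2 cancels the 1/2 in \<open>C n\<close>, so that the
      \<open>S\<close> half sends the added term exactly to \<open>y'\<close>.\<close>
    define z where "z = x' + 2 *\<^sub>R (T ^^ n) y'"
    have zX: "z \<in> X"
      unfolding z_def using x' y' TX by (intro subspace_add[OF X(2)] subspace_scale[OF X(2)])
    have "dist z x' < 2 * \<epsilon>"
      using small(3) by (simp add: z_def dist_norm)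
    then have "dist x z < e1"
      using d(1) \<epsilon>(1,2) dist_triangle[of z x x'] by (simp add: dist_commute)
    then have "z \<in> O1" using zX b(1) by auto
    have lin: "linear (T ^^ n)" "linear (S ^^ n)"
      using T S bounded_linear_funpow bounded_linear.linear by blast+
    have "C n z = y' + (T ^^ n) ((T ^^ n) y') + (1/2) *\<^sub>R ((T ^^ n) x' + (S ^^ n) x')"
      using funpow_inverse[of S T, OF ST]
      by (simp add: C z_def linear_add[OF lin(1)] linear_add[OF lin(2)] linear_scale[OF lin(1)]
          linear_scale[OF lin(2)] scaleR_add_right)
    then have "dist (C n z) y'
        = norm ((T ^^ n) ((T ^^ n) y') + (1/2) *\<^sub>R ((T ^^ n) x' + (S ^^ n) x'))"
      by (simp add: dist_norm)
    also have "\<dots> \<le> norm ((T ^^ n) ((T ^^ n) y'))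
        + (1/2) * (norm ((T ^^ n) x') + norm ((S ^^ n) x'))"
      by (rule order_trans[OF norm_triangle_ineq]) (simp add: norm_triangle_ineq)
    also have "\<dots> < 2 * \<epsilon>"
      using small(1,2) small2 by (simp add: field_simps)
    finally have "dist y (C n z) < e2"
      using d(2) \<epsilon>(1,3) dist_triangle[of "C n z" y y'] by (simp add: dist_commute)
    moreover have "C n z \<in> X"
      using zX by (auto simp: C intro!: subspace_scale[OF X(2)] subspace_add[OF X(2)] TX SX)
    ultimately have "C n z \<in> O2" using b(2) by auto
    with \<open>z \<in> O1\<close> n show "\<exists>n\<ge>1. C n ` O1 \<inter> O2 \<noteq> {}" by blast
  qed
qed


section \<open>Compact operators\<close>

text \<open>Completeness of the underlying space makes the operator type a Banach space, as the
  criterion requires.\<close>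

instance chilbert_space \<subseteq> banach ..

section \<open>Complex scalars and the closed real subspace of complex-linear operators\<close>

lemma module_scaleC: "module (scaleC :: complex \<Rightarrow> 'a::complex_inner \<Rightarrow> 'a)"
  by unfold_locales (simp_all add: scaleC_add_right scaleC_add_left scaleC_scaleC scaleC_one)

lemma scaleC_scaleR: "c *\<^sub>C (r *\<^sub>R x) = r *\<^sub>R (c *\<^sub>C (x::'a::complex_inner))"
  by (simp add: scaleR_scaleC scaleC_scaleC mult.commute)

lemma bounded_ops_compose: "F \<in> bounded_ops \<Longrightarrow> G \<in> bounded_ops \<Longrightarrow> F o\<^sub>L G \<in> bounded_ops"
  by (simp add: bounded_ops_def)

lemma bounded_ops_subspace: "subspace bounded_ops"
  \<comment> \<open>The instance of \<open>scaleC_scaleR\<close> at the real scalar 0 says that a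
    complex multiple of 0 is 0, which the zero operator requires.\<close>
  by (auto simp: subspace_def bounded_ops_def blinfun.add_left blinfun.scaleR_left
      scaleC_add_right scaleC_scaleR intro: scaleC_scaleR[of _ 0, simplified])

lemma bounded_linear_scaleC: "bounded_linear (\<lambda>x::'a::complex_inner. c *\<^sub>C x)"
proof (rule bounded_linear_intro)
  fix x :: 'a
  have "cinner (c *\<^sub>C x) (c *\<^sub>C x) = c * cnj c * cinner x x"
    \<comment> \<open>The two instances of \<open>cinner_commute\<close> bring \<open>c\<close> out
      of the second argument as \<open>cnj c\<close> and remove the conjugate from
      \<open>cinner x x\<close>.\<close>
    by (simp add: cinner_scaleC_left cinner_commute[of x "c *\<^sub>C x"]
        flip: cinner_commute[of x x])
  also have "c * cnj c = complex_of_real ((cmod c)\<^sup>2)"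
    by (rule complex_norm_square[symmetric])
  finally have "Re (cinner (c *\<^sub>C x) (c *\<^sub>C x)) = (cmod c)\<^sup>2 * Re (cinner x x)"
    by simp
  then show "norm (c *\<^sub>C x) \<le> norm x * cmod c"
    by (simp add: norm_eq_sqrt_cinner[where 'a='a] real_sqrt_mult)
qed (simp_all add: scaleC_add_right scaleC_scaleR)

text \<open>For each fixed \<open>c\<close> and \<open>x\<close>, complex linearity equates two
  continuous functions of \<open>F\<close>; the set is an intersection of such closed sets.\<close>

lemma bounded_ops_closed: "closed (bounded_ops :: ('a::complex_inner \<Rightarrow>\<^sub>L 'a) set)"
proof -
  have "closed {F :: 'a \<Rightarrow>\<^sub>L 'a. F (c *\<^sub>C x) = c *\<^sub>C F x}" for c x
    by (intro closed_Collect_eq linear_continuous_on continuous_intros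
        bounded_linear_compose[OF bounded_linear_scaleC] bounded_linear_intros)
  then show ?thesis
    unfolding bounded_ops_def by (intro closed_Collect_all)
qed

section \<open>Compact operators as a norm-closed two-sided ideal\<close>

lemma compact_opsI:
  assumes "F \<in> bounded_ops" and "\<And>S. bounded S \<Longrightarrow> \<exists>K. compact K \<and> blinfun_apply F ` S \<subseteq> K"
  shows "F \<in> compact_ops"
proof -
  have "compact (closure (F ` S))" if S: "bounded S" for S
  proof -
    obtain K where K: "compact K" "F ` S \<subseteq> K" using assms(2)[OF S] by blast
    then have "K \<inter> closure (F ` S) = closure (F ` S)"
      using closure_minimal compact_imp_closed by blast
    then show ?thesis using compact_Int_closed[OF K(1), of "closure (F ` S)"] by simp
  qed
  then show ?thesis using assms(1) by (simp add: compact_ops_def)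
qed

lemma compact_opsE:
  assumes "F \<in> compact_ops" "bounded S"
  obtains K where "compact K" "blinfun_apply F ` S \<subseteq> K"
  using assms by (intro that[OF _ closure_subset]) (simp add: compact_ops_def)

lemma compact_ops_bounded_ops: "F \<in> compact_ops \<Longrightarrow> F \<in> bounded_ops"
  by (simp add: compact_ops_def)

lemma compact_ops_subspace: "subspace (compact_ops :: ('a::complex_inner \<Rightarrow>\<^sub>L 'a) set)"
proof (rule subspaceI)
  show "0 \<in> (compact_ops :: ('a \<Rightarrow>\<^sub>L 'a) set)"
    by (rule compact_opsI) (auto simp: subspace_0[OF bounded_ops_subspace] intro!: exI[of _ "{0}"])
next
  fix F G :: "'a \<Rightarrow>\<^sub>L 'a"
  assume F: "F \<in> compact_ops" and G: "G \<in> compact_ops"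
  show "F + G \<in> compact_ops"
  proof (rule compact_opsI)
    show "F + G \<in> bounded_ops"
      using F G by (simp add: subspace_add[OF bounded_ops_subspace] compact_ops_bounded_ops)
    fix S :: "'a set" assume S: "bounded S"
    obtain K where K: "compact K" "F ` S \<subseteq> K" using compact_opsE[OF F S] .
    obtain L where L: "compact L" "G ` S \<subseteq> L" using compact_opsE[OF G S] .
    \<comment> \<open>By \<open>compact_opsI\<close> any compact superset of the image will do, so
      no closure of a sum has to be computed.\<close>
    have "(F + G) ` S \<subseteq> {x + y |x y. x \<in> K \<and> y \<in> L}"
      using K(2) L(2) by (fastforce simp: blinfun.add_left)
    then show "\<exists>K. compact K \<and> (F + G) ` S \<subseteq> K"
      using compact_sums[OF K(1) L(1)] by blast
  qed
next
  fix r and F :: "'a \<Rightarrow>\<^sub>L 'a"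
  assume F: "F \<in> compact_ops"
  show "r *\<^sub>R F \<in> compact_ops"
  proof (rule compact_opsI)
    show "r *\<^sub>R F \<in> bounded_ops"
      using F by (simp add: subspace_scale[OF bounded_ops_subspace] compact_ops_bounded_ops)
    fix S :: "'a set" assume S: "bounded S"
    obtain K where K: "compact K" "F ` S \<subseteq> K" using compact_opsE[OF F S] .
    then show "\<exists>K. compact K \<and> (r *\<^sub>R F) ` S \<subseteq> K"
      by (intro exI[of _ "(*\<^sub>R) r ` K"]) (auto simp: blinfun.scaleR_left intro: compact_scaling)
  qed
qed

lemma compact_ops_compose_left:
  assumes A: "A \<in> bounded_ops" and F: "F \<in> compact_ops"
  shows "A o\<^sub>L F \<in> compact_ops"
proof (rule compact_opsI)
  show "A o\<^sub>L F \<in> bounded_ops" using A F bounded_ops_compose compact_ops_bounded_ops by blast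
  fix S :: "'a set" assume S: "bounded S"
  obtain K where K: "compact K" "F ` S \<subseteq> K" using compact_opsE[OF F S] .
  have "compact (A ` K)"
    using K(1) by (intro compact_continuous_image linear_continuous_on blinfun.bounded_linear_right)
  then show "\<exists>K. compact K \<and> (A o\<^sub>L F) ` S \<subseteq> K"
    using K(2) by (intro exI[of _ "A ` K"]) (auto simp: image_subset_iff)
qed

lemma compact_ops_compose_right:
  assumes A: "A \<in> bounded_ops" and F: "F \<in> compact_ops"
  shows "F o\<^sub>L A \<in> compact_ops"
proof (rule compact_opsI)
  show "F o\<^sub>L A \<in> bounded_ops" using A F bounded_ops_compose compact_ops_bounded_ops by blast
  fix S :: "'a set" assume S: "bounded S"
  have "bounded (A ` S)"
    using S by (rule bounded_linear_image) (rule blinfun.bounded_linear_right)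
  then obtain K where "compact K" "F ` (A ` S) \<subseteq> K" using compact_opsE[OF F] by blast
  then show "\<exists>K. compact K \<and> (F o\<^sub>L A) ` S \<subseteq> K"
    by (intro exI[of _ K]) auto
qed

text \<open>In a complete space compactness of a closed set is total boundedness, and a finite net
  for the image under a nearby compact \<open>G\<close> is a coarser net for the image under
  \<open>F\<close>.\<close>

lemma compact_ops_closed: "closed (compact_ops :: ('a::chilbert_space \<Rightarrow>\<^sub>L 'a) set)"
  unfolding closure_subset_eq[symmetric]
proof
  fix F :: "'a \<Rightarrow>\<^sub>L 'a"
  assume F: "F \<in> closure compact_ops"
  then have near: "\<forall>\<epsilon>>0. \<exists>G\<in>compact_ops. dist G F < \<epsilon>"
    by (simp add: closure_approachable)
  have "F \<in> bounded_ops"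
    using F closure_minimal[OF _ bounded_ops_closed] compact_ops_bounded_ops by blast
  moreover have "compact (closure (F ` S))" if S: "bounded S" for S
    unfolding compact_eq_totally_bounded
  proof (intro conjI allI impI)
    show "complete (closure (F ` S))" by (simp add: complete_eq_closed)
    fix \<epsilon> :: real assume \<epsilon>: "0 < \<epsilon>"
    obtain b where b: "0 < b" "\<And>x. x \<in> S \<Longrightarrow> norm x \<le> b"
      using S unfolding bounded_pos by blast
    \<comment> \<open>As \<open>b\<close> bounds \<open>S\<close>, this tolerance moves each image
      point by at most \<open>\<epsilon>/3\<close>.\<close>
    obtain G where G: "G \<in> compact_ops" "dist G F < \<epsilon> / (3 * b)"
      using near \<epsilon> b(1) by (metis divide_pos_pos mult_pos_pos zero_less_numeral)
    obtain K where K: "compact K" "G ` S \<subseteq> K" using compact_opsE[OF G(1) S] .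
    obtain k where k: "finite k" "K \<subseteq> (\<Union>x\<in>k. ball x (\<epsilon>/3))"
      using K(1) \<epsilon> unfolding compact_eq_totally_bounded by (meson divide_pos_pos zero_less_numeral)
    \<comment> \<open>Finitely many closed balls have a closed union, which therefore contains the
      closure; the slack up to \<open>\<epsilon>\<close> then gives open balls.\<close>
    have "F ` S \<subseteq> (\<Union>x\<in>k. cball x (2 * \<epsilon>/3))"
    proof clarify
      fix x assume x: "x \<in> S"
      then obtain y where y: "y \<in> k" "dist y (G x) < \<epsilon>/3"
        using K(2) k(2) by fastforce
      have "dist (G x) (F x) \<le> dist G F * norm x"
        by (metis blinfun.diff_left dist_norm norm_blinfun)
      also have "\<dots> \<le> \<epsilon> / (3 * b) * b"
        using G(2) b x \<epsilon> by (intro mult_mono) auto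
      also have "\<dots> = \<epsilon>/3" using b(1) by simp
      finally have "dist y (F x) \<le> 2 * \<epsilon>/3"
        using y(2) dist_triangle[of y "F x" "G x"] by linarith
      then show "F x \<in> (\<Union>x\<in>k. cball x (2 * \<epsilon>/3))" using y(1) by auto
    qed
    then have "closure (F ` S) \<subseteq> (\<Union>x\<in>k. cball x (2 * \<epsilon>/3))"
      using k(1) by (intro closure_minimal closed_UN) auto
    also have "\<dots> \<subseteq> (\<Union>x\<in>k. ball x \<epsilon>)" using \<epsilon> by force
    finally show "\<exists>k. finite k \<and> closure (F ` S) \<subseteq> (\<Union>x\<in>k. ball x \<epsilon>)"
      using k(1) by blast
  qed
  ultimately show "F \<in> compact_ops" unfolding compact_ops_def by blast
qed

text \<open>Strong convergence becomes uniform on a compact set containing the image of the unit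
  ball: it is checked on a finite net, and the contractions \<open>I - P m\<close> control the
  rest.\<close>

lemma compact_ops_approx_strong_limit:
  assumes F: "F \<in> compact_ops"
    and P: "\<And>m x. m \<ge> 1 \<Longrightarrow> norm (x - blinfun_apply (P m) x) \<le> norm x"
    and lim: "\<And>x. (\<lambda>m. blinfun_apply (P m) x) \<longlonglongrightarrow> x"
    and \<epsilon>: "0 < \<epsilon>"
  shows "\<forall>\<^sub>F m in sequentially. dist (P m o\<^sub>L F) F < \<epsilon>"
proof -
  obtain K where K: "compact K" "F ` cball 0 1 \<subseteq> K"
    using compact_opsE[OF F bounded_cball] .
  obtain k where k: "finite k" "K \<subseteq> (\<Union>x\<in>k. ball x (\<epsilon>/4))"
    using K(1) \<epsilon> unfolding compact_eq_totally_bounded by (meson divide_pos_pos zero_less_numeral)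
  have "\<forall>\<^sub>F m in sequentially. \<forall>x\<in>k. dist (P m x) x < \<epsilon>/4"
    using k(1) \<epsilon> lim[THEN tendstoD, of "\<epsilon>/4"] by (intro eventually_ball_finite) auto
  then show ?thesis
    \<comment> \<open>The contraction bound is assumed only for \<open>m \<ge> 1\<close>.\<close>
    using eventually_ge_at_top[of 1]
  proof eventually_elim
    case (elim m)
    have "norm (((P m o\<^sub>L F) - F) x) \<le> \<epsilon>/2 * norm x" for x
    proof (cases "x = 0")
      case False
      define u where "u = (1 / norm x) *\<^sub>R x"
      have "F u \<in> K"
        using K(2) False by (auto simp: u_def)
      then obtain y where y: "y \<in> k" "dist y (F u) < \<epsilon>/4" using k(2) by auto
      \<comment> \<open>Split at the net point \<open>y\<close>: contraction handles
        \<open>F u - y\<close>, and convergence handles \<open>y\<close>.\<close>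
      have "norm (F u - P m (F u)) \<le> norm ((F u - y) - P m (F u - y)) + norm (y - P m y)"
        by (rule order_trans[OF _ norm_triangle_ineq]) (simp add: blinfun.diff_right)
      also have "\<dots> \<le> norm (F u - y) + norm (y - P m y)"
        using P elim by simp
      also have "\<dots> \<le> \<epsilon>/4 + \<epsilon>/4"
        using y elim by (intro add_mono) (auto simp: dist_norm norm_minus_commute less_imp_le)
      finally have "norm (((P m o\<^sub>L F) - F) u) \<le> \<epsilon>/2"
        using \<epsilon> by (simp add: blinfun.diff_left norm_minus_commute)
      then show ?thesis
        using False \<epsilon> by (simp add: u_def blinfun.scaleR_right divide_le_eq mult.commute)
    qed (simp add: blinfun.zero_right)
    then have "norm ((P m o\<^sub>L F) - F) \<le> \<epsilon>/2"
      using \<epsilon> by (intro norm_blinfun_bound) auto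
    then show ?case unfolding dist_norm using \<epsilon> by linarith
  qed
qed


section \<open>Orthogonal projections and unitary operators\<close>

lemma pythagoras:
  fixes x y :: "'a::complex_inner"
  assumes "cinner x y = 0"
  shows "(norm (x + y))\<^sup>2 = (norm x)\<^sup>2 + (norm y)\<^sup>2"
proof -
  have sq: "(norm z)\<^sup>2 = Re (cinner z z)" for z :: 'a
    by (simp add: norm_eq_sqrt_cinner cinner_ge_zero)
  have yx: "cinner y x = 0" using cinner_commute[of y x] assms by simp
  have right: "cinner z (x + y) = cinner z x + cinner z y" for z
    by (metis cinner_add_left cinner_commute complex_cnj_add)
  show ?thesis by (simp add: sq cinner_add_left right assms yx)
qed

text \<open>The residual is orthogonal to \<open>P x - y\<close>, which lies in the span, so
  Pythagoras applies. Taking \<open>y = 0\<close> also gives the contraction bound for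
  \<open>I - P\<close>.\<close>

lemma orthogonal_projection_nearest:
  assumes P: "is_orthogonal_projection P (cspan B)" and y: "y \<in> cspan B"
  shows "norm (x - blinfun_apply P x) \<le> norm (x - y)"
proof -
  have "P x - y \<in> cspan B"
    using P y module.span_diff[OF module_scaleC] unfolding is_orthogonal_projection_def by blast
  then have "cinner (x - P x) (P x - y) = 0"
    using P unfolding is_orthogonal_projection_def by blast
  then have "(norm (x - y))\<^sup>2 = (norm (x - P x))\<^sup>2 + (norm (P x - y))\<^sup>2"
    using pythagoras by fastforce
  then show ?thesis
    by (metis le_add_same_cancel1 norm_ge_zero power2_le_imp_le zero_le_power2)
qed

lemma cspan_range_bounded_index:
  assumes "y \<in> cspan (range e)"
  shows "\<exists>M::nat. y \<in> cspan (e ` {..<M})"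
proof -
  obtain t r where t: "finite t" "t \<subseteq> range e" and y: "y = (\<Sum>a\<in>t. r a *\<^sub>C a)"
    using assms unfolding module.span_explicit[OF module_scaleC] by blast
  obtain J where J: "finite J" "t = e ` J"
    using finite_subset_image[OF t] by blast
  then obtain M where "J \<subseteq> {..<M}" using finite_nat_iff_bounded by blast
  then have "t \<subseteq> e ` {..<M}" using J(2) by blast
  then show ?thesis
    unfolding y by (intro exI[of _ M] module.span_sum[OF module_scaleC]
        module.span_scale[OF module_scaleC] module.span_base[OF module_scaleC]) blast
qed

text \<open>A vector \<open>y\<close> of the span near \<open>x\<close> lies in all but finitely
  many of the nested finite spans, and there the projection of \<open>x\<close> is at least as close
  to \<open>x\<close> as \<open>y\<close>. Indices start at 0, so \<open>{..<m}\<close> selects the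
  first \<open>m\<close> basis vectors.\<close>

lemma basis_projection_tendsto:
  assumes e: "orthonormal_basis e"
    and P: "\<And>m. m \<ge> 1 \<Longrightarrow> is_orthogonal_projection (P m) (cspan (e ` {..<m}))"
  shows "(\<lambda>m. blinfun_apply (P m) x) \<longlonglongrightarrow> x"
proof (rule tendstoI)
  fix \<epsilon> :: real assume "0 < \<epsilon>"
  moreover have "x \<in> closure (cspan (range e))" using e by (simp add: orthonormal_basis_def)
  ultimately obtain y where y: "y \<in> cspan (range e)" "dist y x < \<epsilon>"
    unfolding closure_approachable by blast
  obtain M where M: "y \<in> cspan (e ` {..<M})"
    using cspan_range_bounded_index[OF y(1)] by blast
  show "\<forall>\<^sub>F m in sequentially. dist (P m x) x < \<epsilon>"
    using eventually_ge_at_top[of "max 1 M"]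
  proof eventually_elim
    case (elim m)
    then have "y \<in> cspan (e ` {..<m})"
      using M module.span_mono[OF module_scaleC image_mono, of "{..<M}" "{..<m}" e] by auto
    then have "norm (x - P m x) \<le> norm (x - y)"
      using elim by (intro orthogonal_projection_nearest[OF P]) auto
    then show ?case using y(2) by (simp add: dist_norm norm_minus_commute)
  qed
qed

section \<open>Inverses of operators and isometry of unitary operators\<close>

lemma blinfun_compose_assoc: "(F o\<^sub>L G) o\<^sub>L H = F o\<^sub>L (G o\<^sub>L H)"
  by (rule blinfun_eqI) simp

lemma blinfun_compose_id [simp]: "F o\<^sub>L id_blinfun = F" "id_blinfun o\<^sub>L F = F"
  by (auto intro: blinfun_eqI)

lemma inverse_op_eqI:
  assumes "is_inverse_op F G"
  shows "inverse_op F = G"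
  unfolding inverse_op_def
proof (rule the_equality[where P = "is_inverse_op F", OF assms])
  fix H assume "is_inverse_op F H"
  then have "H o\<^sub>L F = id_blinfun" "F o\<^sub>L G = id_blinfun"
    using assms by (simp_all add: is_inverse_op_def)
  then show "H = G" using blinfun_compose_assoc[of H F G] by simp
qed

lemma inverse_op_is_inverse: "invertible_op F \<Longrightarrow> is_inverse_op F (inverse_op F)"
  unfolding invertible_op_def using inverse_op_eqI by metis

text \<open>The adjoint is the inverse, and moving it across the inner product shows that
  \<open>U\<close> is isometric. The norm bounds later let the right-hand factors in the iterates of
  \<open>T\<close> and \<open>S\<close> be discarded.\<close>

lemma unitary_op_inverse:
  assumes "unitary_op U"
  shows "is_inverse_op U (inverse_op U)" "norm U \<le> 1" "norm (inverse_op U) \<le> 1"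
proof -
  obtain G where G: "is_adjoint U G" "G o\<^sub>L U = id_blinfun" "U o\<^sub>L G = id_blinfun"
    using assms unfolding unitary_op_def by blast
  have inv: "is_inverse_op U G" using G by (auto simp: is_inverse_op_def is_adjoint_def)
  have GU: "G (U x) = x" and UG: "U (G x) = x" for x
    using G(2,3) by (metis blinfun_apply_blinfun_compose id_blinfun.rep_eq)+
  have U: "norm (U x) = norm x" for x
    using G(1) GU by (simp add: norm_eq_sqrt_cinner is_adjoint_def)
  have "norm (G x) = norm x" for x
    using U[of "G x"] UG by simp
  then show "norm U \<le> 1" "norm (inverse_op U) \<le> 1"
    using U inverse_op_eqI[OF inv] by (auto intro!: norm_blinfun_bound)
  show "is_inverse_op U (inverse_op U)" using inv inverse_op_eqI[OF inv] by simp
qed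


section \<open>The operators \<open>T\<close> and \<open>S\<close>\<close>

text \<open>With this, each fact about \<open>T_op\<close> also covers \<open>S_op\<close>.\<close>

lemma S_op_eq_T_op: "S_op U W = T_op (inverse_op U) (inverse_op W)"
  by (rule ext) (simp add: S_op_def T_op_def)

lemma bounded_linear_T_op: "bounded_linear (T_op U W)"
  unfolding T_op_def
  by (intro bounded_linear_intros bounded_linear_compose[OF
        bounded_bilinear.bounded_linear_left[OF bounded_bilinear_blinfun_compose]]
        bounded_bilinear.bounded_linear_right[OF bounded_bilinear_blinfun_compose])

lemma T_op_compact_ops:
  "U \<in> bounded_ops \<Longrightarrow> W \<in> bounded_ops \<Longrightarrow> F \<in> compact_ops \<Longrightarrow> T_op U W F \<in> compact_ops"
  by (simp add: T_op_def compact_ops_compose_left compact_ops_compose_right)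

lemma T_op_inverse:
  assumes "U o\<^sub>L U' = id_blinfun" "W' o\<^sub>L W = id_blinfun"
  shows "T_op U' W' (T_op U W F) = F"
proof -
  have "U (U' x) = x" "W' (W x) = x" for x
    using assms by (metis blinfun_apply_blinfun_compose id_blinfun.rep_eq)+
  then show ?thesis by (intro blinfun_eqI) (simp add: T_op_def)
qed

lemma norm_T_op_funpow_le:
  assumes "norm U \<le> 1"
  shows "norm ((T_op U W ^^ n) F) \<le> norm (op_power W n o\<^sub>L F)"
proof -
  \<comment> \<open>\<open>R\<close> stands for the \<open>n\<close>-th power of \<open>U\<close>.
    Only its contractivity matters, and leaving it abstract avoids reordering powers, since
    iteration appends \<open>U\<close> on the right while \<open>op_power\<close> adds factors on
    the left.\<close>
  have "\<exists>R. norm R \<le> 1 \<and> (T_op U W ^^ n) F = op_power W n o\<^sub>L F o\<^sub>L R"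
  proof (induction n)
    case 0
    show ?case
      by (intro exI[of _ id_blinfun])
        (auto simp: op_power_def intro!: norm_blinfun_bound blinfun_eqI)
  next
    case (Suc n)
    then obtain R where R: "norm R \<le> 1" "(T_op U W ^^ n) F = op_power W n o\<^sub>L F o\<^sub>L R"
      by blast
    have "norm (R o\<^sub>L U) \<le> 1"
      using norm_blinfun_compose[of R U] mult_le_one[OF R(1) _ assms] by simp
    moreover have "(T_op U W ^^ Suc n) F = op_power W (Suc n) o\<^sub>L F o\<^sub>L (R o\<^sub>L U)"
      by (simp add: R(2)) (intro blinfun_eqI, simp add: T_op_def op_power_def)
    ultimately show ?case by blast
  qed
  then obtain R where R: "norm R \<le> 1" "(T_op U W ^^ n) F = op_power W n o\<^sub>L F o\<^sub>L R" by blast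
  then show ?thesis
    using norm_blinfun_compose[of "op_power W n o\<^sub>L F" R]
      mult_left_le[of "norm R" "norm (op_power W n o\<^sub>L F)"] by simp
qed

text \<open>Compare termwise: \<open>P\<close> stays next to the power of \<open>W\<close>, the
  contraction coming from \<open>U\<close> is dropped, and \<open>F\<close> contributes the constant
  factor \<open>norm F\<close>.\<close>

lemma small_orbit_sum_T_op:
  assumes U: "norm U \<le> 1"
    and s: "summable (\<lambda>l. norm (op_power W (Suc l * n) o\<^sub>L P))"
    and F: "(\<Sum>l. norm (op_power W (Suc l * n) o\<^sub>L P)) * norm F < \<epsilon>"
  shows "small_orbit_sum (T_op U W) n \<epsilon> (P o\<^sub>L F)"
proof -
  have le: "norm ((T_op U W ^^ (Suc l * n)) (P o\<^sub>L F))
      \<le> norm (op_power W (Suc l * n) o\<^sub>L P) * norm F" for l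
    using norm_T_op_funpow_le[OF U, where W = W and n = "Suc l * n" and F = "P o\<^sub>L F"]
      norm_blinfun_compose[of "op_power W (Suc l * n) o\<^sub>L P" F]
    by (simp only: blinfun_compose_assoc)
  have sF: "summable (\<lambda>l. norm (op_power W (Suc l * n) o\<^sub>L P) * norm F)"
    using s by (rule summable_mult2)
  have sT: "summable (\<lambda>l. norm ((T_op U W ^^ (Suc l * n)) (P o\<^sub>L F)))"
    using le by (intro summable_comparison_test'[OF sF]) auto
  then show ?thesis
    using suminf_le[OF le sT sF] F unfolding small_orbit_sum_def suminf_mult2[OF s] by linarith
qed

section \<open>Chaos on the compact operators, by verifying the criterion\<close>

theorem theorem4p7:
  fixes e :: "nat \<Rightarrow> 'a::chilbert_space"
    and U W :: "'a \<Rightarrow>\<^sub>L 'a"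
    and P :: "nat \<Rightarrow> ('a \<Rightarrow>\<^sub>L 'a)"
  assumes basis: "orthonormal_basis e"
    and W: "W \<in> bounded_ops" "invertible_op W"
    and U: "U \<in> bounded_ops" "unitary_op U"
    and P: "\<And>m. m \<ge> 1 \<Longrightarrow> is_orthogonal_projection (P m) (cspan (e ` {..<m}))"
    and series: "\<And>m. m \<ge> 1 \<Longrightarrow>
      \<exists>n :: nat \<Rightarrow> nat. strict_mono n \<and> (\<forall>k. n k \<ge> 1) \<and>
        (\<forall>k. summable (\<lambda>l. norm (op_power W (Suc l * n k) o\<^sub>L P m))) \<and>
        (\<forall>k. summable (\<lambda>l. norm (op_power (inverse_op W) (Suc l * n k) o\<^sub>L P m))) \<and>
        (\<lambda>k. \<Sum>l. norm (op_power W (Suc l * n k) o\<^sub>L P m)) \<longlonglongrightarrow> 0 \<and>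
        (\<lambda>k. \<Sum>l. norm (op_power (inverse_op W) (Suc l * n k) o\<^sub>L P m)) \<longlonglongrightarrow> 0"
  shows "chaotic_on compact_ops (C_op U W)"
proof (rule chaotic_cosine_criterion[OF compact_ops_closed compact_ops_subspace,
      where T = "T_op U W" and S = "S_op U W"])
  have invW: "inverse_op W \<in> bounded_ops" "inverse_op W o\<^sub>L W = id_blinfun"
      "W o\<^sub>L inverse_op W = id_blinfun"
    using inverse_op_is_inverse[OF W(2)] by (simp_all add: is_inverse_op_def)
  have invU: "inverse_op U \<in> bounded_ops" "inverse_op U o\<^sub>L U = id_blinfun"
      "U o\<^sub>L inverse_op U = id_blinfun"
    using unitary_op_inverse(1)[OF U(2)] by (simp_all add: is_inverse_op_def)
  note normU = unitary_op_inverse(2,3)[OF U(2)]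
  show "bounded_linear (T_op U W)" "bounded_linear (S_op U W)"
    unfolding S_op_eq_T_op by (rule bounded_linear_T_op)+
  show "T_op U W F \<in> compact_ops" "S_op U W F \<in> compact_ops" if "F \<in> compact_ops" for F
    unfolding S_op_eq_T_op using that U(1) W(1) invU(1) invW(1) by (auto intro: T_op_compact_ops)
  show "T_op U W (S_op U W F) = F" "S_op U W (T_op U W F) = F" for F
    unfolding S_op_eq_T_op using invU invW by (auto intro: T_op_inverse)
  show "C_op U W n F = (1/2) *\<^sub>R ((T_op U W ^^ n) F + (S_op U W ^^ n) F)" for n F
    by (rule C_op_def)
  fix F G :: "'a \<Rightarrow>\<^sub>L 'a" and \<epsilon> :: real
  assume F: "F \<in> compact_ops" and G: "G \<in> compact_ops" and \<epsilon>: "0 < \<epsilon>"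
  have "norm (x - P m x) \<le> norm x" if "m \<ge> 1" for m x
    using orthogonal_projection_nearest[OF P[OF that] module.span_zero[OF module_scaleC]] by simp
  note approx = compact_ops_approx_strong_limit[where P = P, OF _ this
      basis_projection_tendsto[OF basis P] \<epsilon>]
  \<comment> \<open>The sequence supplied by \<open>series\<close> depends on \<open>m\<close>, so
    one \<open>m\<close> good for both \<open>F\<close> and \<open>G\<close> is fixed first.\<close>
  obtain m where m: "m \<ge> 1" and d: "dist (P m o\<^sub>L F) F < \<epsilon>" "dist (P m o\<^sub>L G) G < \<epsilon>"
    using eventually_conj[OF eventually_ge_at_top[of 1] eventually_conj[OF approx[OF F] approx[OF G]]]
    unfolding eventually_sequentially by blast
  obtain n :: "nat \<Rightarrow> nat" where n: "\<And>k. n k \<ge> 1"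
    and s: "\<And>k. summable (\<lambda>l. norm (op_power W (Suc l * n k) o\<^sub>L P m))"
      "\<And>k. summable (\<lambda>l. norm (op_power (inverse_op W) (Suc l * n k) o\<^sub>L P m))"
    and lim: "(\<lambda>k. \<Sum>l. norm (op_power W (Suc l * n k) o\<^sub>L P m)) \<longlonglongrightarrow> 0"
      "(\<lambda>k. \<Sum>l. norm (op_power (inverse_op W) (Suc l * n k) o\<^sub>L P m)) \<longlonglongrightarrow> 0"
    using series[OF m] by blast
  have ev: "\<forall>\<^sub>F k in sequentially. (\<Sum>l. norm (op_power V (Suc l * n k) o\<^sub>L P m)) * norm H < \<epsilon>"
    if "(\<lambda>k. \<Sum>l. norm (op_power V (Suc l * n k) o\<^sub>L P m)) \<longlonglongrightarrow> 0" for V H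
    using order_tendstoD(2)[OF tendsto_mult_left_zero[OF that] \<epsilon>] by blast
  \<comment> \<open>Four eventual bounds, for \<open>F\<close> and \<open>G\<close> and for both
    directions of the orbit, are met by one \<open>k\<close>, giving the common \<open>n\<close>
    that the criterion demands.\<close>
  obtain k where k: "\<And>H. H \<in> {F, G} \<Longrightarrow>
      (\<Sum>l. norm (op_power W (Suc l * n k) o\<^sub>L P m)) * norm H < \<epsilon> \<and>
      (\<Sum>l. norm (op_power (inverse_op W) (Suc l * n k) o\<^sub>L P m)) * norm H < \<epsilon>"
    using eventually_conj[OF eventually_conj[OF ev[OF lim(1), of F] ev[OF lim(2), of F]]
        eventually_conj[OF ev[OF lim(1), of G] ev[OF lim(2), of G]]]
    unfolding eventually_sequentially by blast
  have "small_orbit_sum (T_op U W) (n k) \<epsilon> (P m o\<^sub>L H) \<and> small_orbit_sum (S_op U W) (n k) \<epsilon> (P m o\<^sub>L H)"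
    if "H \<in> {F, G}" for H
    unfolding S_op_eq_T_op using k[OF that] s normU by (auto intro: small_orbit_sum_T_op)
  moreover have "P m o\<^sub>L F \<in> compact_ops" "P m o\<^sub>L G \<in> compact_ops"
    using P[OF m] F G by (auto simp: is_orthogonal_projection_def intro: compact_ops_compose_left)
  ultimately show "\<exists>F'\<in>compact_ops. \<exists>G'\<in>compact_ops. dist F' F < \<epsilon> \<and> dist G' G < \<epsilon> \<and>
      (\<exists>n\<ge>1. \<forall>H\<in>{F', G'}. small_orbit_sum (T_op U W) n \<epsilon> H \<and> small_orbit_sum (S_op U W) n \<epsilon> H)"
    using d n[of k] by blast
qed

end
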